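(* Let $Y$ be a finite dimensional Euclidean space, $K\subseteq Y$ a closed convex cone and $F$ a face of $K$. Then $K^*+F^\perp$ is not closed if and only if there are $(a_1,\dots,a_{k+1})\in\mathrm{FR}_{k+1}(K^* )$ with $k\ge1$ and $(y_1,\dots,y_{\ell+1})\in\mathrm{FR}_{\ell+1}(K)$ with $\ell\ge1$ such that $$a_i\in\operatorname{lin}F\ (i=1,\dots,k+1),\qquad y_j\in F^\perp\ (j=1,\dots,\ell),$$ and $$\langle a_i,y_{\ell+1}\rangle=\begin{cases}0&\text{if } i\le k,\\-1&\text{if } i=k+1.\end{cases}$$
   Context: $K^*=\{y\in Y:\langle y,x\rangle\ge0\ \forall x\in K\}$; $\operatorname{lin}F$ is the linear span of $F$ and $F^\perp$ its orthogonal complement. A convex subset $F$ of $K$ is a face of $K$ if $y,z\in K$ and $\frac12(y+z)\in F$ imply $y,z\in F$. For a closed convex cone $C$ and $k\ge1$, $$\mathrm{FR}_k(C)=\{(y_1,\dots,y_k): y_1\in C^*,\ y_i\in(C\cap y_1^\perp\cap\dots\cap y_{i-1}^\perp)^*,\ i=2,\dots,k\}.$$ *)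

theory Defs
  imports "HOL-Analysis.Analysis" "HOL-Library.Set_Algebras"
begin

definition dual_cone :: "'a::real_inner set \<Rightarrow> 'a set"
  where "dual_cone K = {y. \<forall>x\<in>K. y \<bullet> x \<ge> 0}"

text \<open>
  A tuple \<open>(y\<^sub>1, \<dots>, y\<^sub>k)\<close> is represented by a function on \<open>nat\<close>, of which only
  the values at \<open>1, \<dots>, k\<close> matter. The definition is meant for \<open>k \<ge> 1\<close>.
\<close>

definition FR :: "nat \<Rightarrow> 'a::real_inner set \<Rightarrow> (nat \<Rightarrow> 'a) set"
  where "FR k C = {y. y 1 \<in> dual_cone C \<and>
    (\<forall>i\<in>{2..k}. y i \<in> dual_cone (C \<inter> (\<Inter>j\<in>{1..<i}. {y j}\<^sup>\<bottom>)))}"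

text \<open>
  The library notion \<^const>\<open>face_of\<close> is phrased with open segments; on convex sets it
  agrees with the definition by midpoints.
\<close>

lemma face_of_iff_midpoint:
  fixes K F :: "'a::real_vector set"
  assumes "convex K"
  shows "F face_of K \<longleftrightarrow> F \<subseteq> K \<and> convex F \<and>
    (\<forall>y\<in>K. \<forall>z\<in>K. (1/2) *\<^sub>R (y + z) \<in> F \<longrightarrow> y \<in> F \<and> z \<in> F)"
    (is "_ \<longleftrightarrow> _ \<and> _ \<and> ?mid")
proof -
  have seg_mid: ?mid if face: "F face_of K"
  proof (intro ballI impI)
    fix y z assume yz: "y \<in> K" "z \<in> K" and m: "(1/2) *\<^sub>R (y + z) \<in> F"
    show "y \<in> F \<and> z \<in> F"
    proof (cases "y = z")
      case True
      then have "(1/2) *\<^sub>R (y + z) = y"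
        by (simp flip: scaleR_2)
      then show ?thesis
        using m True by simp
    next
      case False
      then have "(1/2) *\<^sub>R (y + z) \<in> open_segment y z"
        unfolding in_segment by (intro conjI exI [of _ "1/2"]) (auto simp: algebra_simps)
      then show ?thesis
        using face yz m face_ofD by blast
    qed
  qed
  have end_in: "b \<in> F"
    if mid: ?mid and "a \<in> K" "b \<in> K" "(1/2)^n \<le> u" "u \<le> 1" "(1 - u) *\<^sub>R a + u *\<^sub>R b \<in> F"
    for a b n and u :: real
    using that(2-6)
  proof (induction n arbitrary: u)
    case 0
    then show ?case by simp
  next
    case (Suc n)
    have K: "(1 - t) *\<^sub>R a + t *\<^sub>R b \<in> K" if "0 \<le> t" "t \<le> 1" for t
      using assms Suc.prems(1,2) that by (simp add: convexD_alt)
    show ?case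
    proof (cases "u \<ge> 1/2")
      case True
      let ?d = "(1 - (2*u - 1)) *\<^sub>R a + (2*u - 1) *\<^sub>R b"
      have "?d \<in> K"
        by (rule K) (use True Suc.prems(4) in auto)
      moreover have "(1/2) *\<^sub>R (?d + b) = (1 - u) *\<^sub>R a + u *\<^sub>R b"
        by (simp add: algebra_simps)
      ultimately show ?thesis
        using mid Suc.prems(2,5) by auto
    next
      case False
      let ?c = "(1 - 2*u) *\<^sub>R a + (2*u) *\<^sub>R b"
      have lower: "(1/2)^n \<le> 2*u"
        using Suc.prems(3) by simp
      have "(0::real) < (1/2)^n" by simp
      then have "0 \<le> 2*u"
        using lower by linarith
      then have "?c \<in> K"
        by (intro K) (use False in auto)
      moreover have "(1/2) *\<^sub>R (a + ?c) = (1 - u) *\<^sub>R a + u *\<^sub>R b"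
      proof -
        have "(1/2) *\<^sub>R (a + ?c) = (1/2 + (1/2) * (1 - 2*u)) *\<^sub>R a + u *\<^sub>R b"
          by (simp only: scaleR_add_right scaleR_add_left scaleR_scaleR add.assoc) simp
        moreover have "1/2 + (1/2) * (1 - 2*u) = 1 - u"
          by (simp add: field_simps)
        ultimately show ?thesis
          by (simp only:)
      qed
      ultimately have "?c \<in> F"
        using mid Suc.prems(1,5) by auto
      then show ?thesis
        using Suc.IH [of "2*u"] Suc.prems(1,2) lower False by simp
    qed
  qed
  have right: "b \<in> F"
    if mid: ?mid and ab: "a \<in> K" "b \<in> K" and x: "x \<in> F" "x \<in> open_segment a b" for a b x
  proof -
    obtain u where u: "0 < u" "u < 1" "x = (1 - u) *\<^sub>R a + u *\<^sub>R b"
      using x(2) by (auto simp: in_segment)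
    obtain n where "(1/2)^n < u"
      using real_arch_pow_inv [OF u(1), of "1/2"] by auto
    then show ?thesis
      using end_in [OF mid ab, of n u] u x(1) by simp
  qed
  show ?thesis
  proof
    assume "F face_of K"
    then show "F \<subseteq> K \<and> convex F \<and> ?mid"
      by (intro conjI seg_mid face_of_imp_subset face_of_imp_convex)
  next
    assume F: "F \<subseteq> K \<and> convex F \<and> ?mid"
    then have mid: ?mid by (elim conjE)
    have "a \<in> F \<and> b \<in> F"
      if ab: "a \<in> K" "b \<in> K" and x: "x \<in> F" "x \<in> open_segment a b" for a b x
    proof
      show "b \<in> F"
        by (rule right [OF mid ab x])
      have "x \<in> open_segment b a"
        using x(2) by (subst open_segment_commute)
      then show "a \<in> F"
        by (rule right [OF mid ab(2,1) x(1)])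
    qed
    then show "F face_of K"
      unfolding face_of_def using F by (intro conjI) blast+
  qed
qed

end

theory Submission
  imports Defs
begin

text \<open>
  By separation, the closure of \<open>K\<^sup>* + F\<^sup>\<bottom>\<close> is \<open>F\<^sup>*\<close>, because \<open>K\<^sup>*\<^sup>* = K\<close> and \<open>K \<inter> lin F = F\<close> for a
  nonempty face. So the sum fails to be closed iff some \<open>z \<in> F\<^sup>*\<close> lies outside \<open>K\<^sup>* + F\<^sup>\<bottom>\<close>.
  The two sequences are certificates for the two halves of this condition.

  The sequence \<open>y\<close> certifies \<open>z \<in> F\<^sup>*\<close>, with \<open>z\<close> as its last entry. If the other entries are
  orthogonal to \<open>F\<close>, then the cone cut out of \<open>K\<close> by them contains \<open>F\<close>, and so its dual is
  contained in \<open>F\<^sup>*\<close>. Conversely (\<open>face_dual_facial_reduction\<close>), facial reduction cuts \<open>K\<close> down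
  to exactly \<open>F\<close>: as long as \<open>F\<close> is a proper face, some hyperplane supports \<open>K\<close>, contains \<open>F\<close>
  and does not contain \<open>K\<close>, so the dimension drops.

  The sequence \<open>a\<close> certifies \<open>z \<notin> K\<^sup>* + F\<^sup>\<bottom>\<close>. If \<open>z = s + f\<close> was a decomposition, then \<open>s\<close> would
  have the same inner products as \<open>z\<close> with all \<open>a\<^sub>i \<in> lin F\<close>; so \<open>s\<close> would stay in \<open>K\<^sup>*\<close> cut by
  \<open>a\<^sub>1, \<dots>, a\<^sub>k\<close>, where \<open>a\<^bsub>k+1\<^esub>\<close> is nonnegative, and yet \<open>\<langle>a\<^bsub>k+1\<^esub>, s\<rangle> = -1\<close>. Conversely
  (\<open>infeasible_facial_reduction\<close>), proper separation of \<open>z\<close> from \<open>K\<^sup>* + F\<^sup>\<bottom>\<close> either separates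
  strictly, which gives the last entry, or yields a hyperplane through \<open>z\<close> that cuts \<open>K\<^sup>*\<close> down
  to a cone of smaller dimension, where the argument is repeated.
\<close>

section \<open>Cones and separation\<close>

lemma convex_cone_Int_orthogonal_comp:
  fixes C :: "'a::euclidean_space set"
  assumes "convex_cone C"
  shows "convex_cone (C \<inter> W\<^sup>\<bottom>)"
  using convex_cone_Inter [of "{C, W\<^sup>\<bottom>}"] assms
  by (auto intro: subspace_imp_convex_cone subspace_orthogonal_comp)

lemma convex_cone_dual_cone: "convex_cone (dual_cone K)"
proof -
  have "dual_cone K = \<Inter> ((\<lambda>x. {y. x \<bullet> y \<ge> 0}) ` K)"
    by (auto simp: dual_cone_def inner_commute)
  then show ?thesis
    using convex_cone_Inter [of "(\<lambda>x. {y. x \<bullet> y \<ge> 0}) ` K"] convex_cone_halfspace_ge by auto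
qed

lemma convex_cone_set_plus:
  assumes "convex_cone C" "convex_cone D"
  shows "convex_cone (C + D)"
proof -
  have "C + D = (\<Union>x\<in>C. \<Union>y\<in>D. {x + y})"
    by (auto simp: set_plus_def)
  then show ?thesis
    using convex_cone_sums [OF assms] by simp
qed

lemma closed_dual_cone: "closed (dual_cone K)"
proof -
  have "dual_cone K = (\<Inter>x\<in>K. {y. x \<bullet> y \<ge> 0})"
    by (auto simp: dual_cone_def inner_commute)
  then show ?thesis
    by (auto intro: closed_halfspace_ge)
qed

lemma subset_set_plus_left:
  fixes C L :: "'a::real_vector set"
  assumes "subspace L"
  shows "C \<subseteq> C + L"
  using set_zero_plus2 [OF subspace_0 [OF assms], of C] by (simp add: add.commute)

text \<open>
  If the functional were negative at \<open>x\<close>, then it would tend to \<open>-\<infinity>\<close> along the ray through \<open>x\<close>.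
\<close>

lemma convex_cone_inner_nonneg:
  assumes cone: "convex_cone D" and bound: "\<And>x. x \<in> D \<Longrightarrow> b \<le> a \<bullet> x" and "x \<in> D"
  shows "0 \<le> a \<bullet> x"
proof (rule ccontr)
  assume neg: "\<not> 0 \<le> a \<bullet> x"
  define t where "t = (\<bar>b\<bar> + 1) / (- (a \<bullet> x))"
  have "t \<ge> 0"
    using neg unfolding t_def by (intro divide_nonneg_nonneg) auto
  then have "b \<le> a \<bullet> (t *\<^sub>R x)"
    using convex_cone_scaleR [OF cone _ \<open>x \<in> D\<close>] bound by blast
  moreover have "a \<bullet> (t *\<^sub>R x) = - (\<bar>b\<bar> + 1)"
    using neg by (simp add: t_def)
  ultimately show False
    by linarith
qed

text \<open>
  On a subspace, nonnegativity applies to \<open>x\<close> and \<open>-x\<close> and so forces orthogonality.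
\<close>

lemma dual_cone_set_plus_subspace:
  fixes C L :: "'a::real_inner set"
  assumes "convex_cone C" "subspace L" and nonneg: "\<And>x. x \<in> C + L \<Longrightarrow> 0 \<le> a \<bullet> x"
  shows "a \<in> dual_cone C" and "a \<in> L\<^sup>\<bottom>"
proof -
  show "a \<in> dual_cone C"
    using nonneg subset_set_plus_left [OF \<open>subspace L\<close>] by (auto simp: dual_cone_def)
  have "a \<bullet> x = 0" if "x \<in> L" for x
  proof -
    have "L \<subseteq> C + L"
      by (rule set_zero_plus2 [OF convex_cone_contains_0 [OF \<open>convex_cone C\<close>]])
    then have "0 \<le> a \<bullet> x" "0 \<le> a \<bullet> (- x)"
      using that subspace_neg [OF \<open>subspace L\<close>] by (blast intro: nonneg)+
    then show ?thesis by simp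
  qed
  then show "a \<in> L\<^sup>\<bottom>"
    by (simp add: orthogonal_comp_def orthogonal_def inner_commute)
qed

lemma separate_from_closure_convex_cone:
  fixes D :: "'a::euclidean_space set"
  assumes cone: "convex_cone D" and "z \<notin> closure D"
  obtains a where "a \<bullet> z < 0" "\<And>x. x \<in> D \<Longrightarrow> 0 \<le> a \<bullet> x"
proof -
  have "convex (closure D)"
    using cone by (simp add: convex_cone_def convex_closure)
  then obtain a b where ab: "a \<bullet> z < b" "\<forall>x\<in>closure D. b < a \<bullet> x"
    using separating_hyperplane_closed_point [OF _ closed_closure \<open>z \<notin> closure D\<close>] by blast
  have bound: "b \<le> a \<bullet> x" if "x \<in> D" for x
    using ab(2) that closure_subset [of D] by (meson less_imp_le subsetD)
  have "b \<le> 0"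
    using bound [OF convex_cone_contains_0 [OF cone]] by simp
  then show thesis
    using that [of a] ab(1) convex_cone_inner_nonneg [OF cone bound] by fastforce
qed

lemma dual_cone_dual_cone:
  fixes K :: "'a::euclidean_space set"
  assumes "closed K" "convex_cone K"
  shows "dual_cone (dual_cone K) = K"
proof
  show "K \<subseteq> dual_cone (dual_cone K)"
    by (auto simp: dual_cone_def inner_commute)
  show "dual_cone (dual_cone K) \<subseteq> K"
  proof
    fix z assume z: "z \<in> dual_cone (dual_cone K)"
    show "z \<in> K"
    proof (rule ccontr)
      assume "z \<notin> K"
      then obtain a where a: "a \<bullet> z < 0" "\<And>x. x \<in> K \<Longrightarrow> 0 \<le> a \<bullet> x"
        using separate_from_closure_convex_cone [OF assms(2), of z] assms(1) by auto
      then have "a \<in> dual_cone K"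
        by (auto simp: dual_cone_def)
      then show False
        using z a(1) by (fastforce simp: dual_cone_def inner_commute)
    qed
  qed
qed

section \<open>Faces and the closure of the sum\<close>

lemma orthogonal_comp_orthogonal_comp:
  fixes F :: "'a::euclidean_space set"
  shows "F\<^sup>\<bottom>\<^sup>\<bottom> = span F"
proof -
  have "F\<^sup>\<bottom> = (span F)\<^sup>\<bottom>"
    unfolding orthogonal_comp_def by (auto intro: orthogonal_to_span span_base simp: orthogonal_commute)
  then show ?thesis
    using orthogonal_comp_self [OF subspace_span, of F] by simp
qed

lemma face_of_convex_cone_contains_0:
  fixes K :: "'a::euclidean_space set"
  assumes "convex_cone K" "F face_of K" "F \<noteq> {}"
  shows "0 \<in> F"
proof -
  have "conic F"
    using assms face_of_conic by (auto simp: convex_cone_def)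
  then show ?thesis
    using assms(3) by (simp add: conic_contains_0)
qed

lemma span_face_Int_convex_cone:
  fixes K :: "'a::euclidean_space set"
  assumes "convex_cone K" "F face_of K" "F \<noteq> {}"
  shows "span F \<inter> K = F"
proof -
  have "affine hull F = span F"
    using face_of_convex_cone_contains_0 [OF assms] by (simp add: affine_hull_span_0 hull_inc)
  then show ?thesis
    using face_of_imp_eq_affine_Int [OF _ assms(2)] assms(1) by (auto simp: convex_cone_def)
qed

text \<open>
  A functional separating a point from \<open>K\<^sup>* + F\<^sup>\<bottom>\<close> lies in \<open>K\<^sup>*\<^sup>* \<inter> F\<^sup>\<bottom>\<^sup>\<bottom> = K \<inter> lin F = F\<close>,
  and hence excludes the point from \<open>F\<^sup>*\<close>.
\<close>

lemma closure_dual_cone_plus_orthogonal_comp: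
  fixes K F :: "'a::euclidean_space set"
  assumes "closed K" "convex_cone K" "F face_of K" "F \<noteq> {}"
  shows "closure (dual_cone K + F\<^sup>\<bottom>) = dual_cone F"
proof
  have "dual_cone K + F\<^sup>\<bottom> \<subseteq> dual_cone F"
  proof
    fix w assume "w \<in> dual_cone K + F\<^sup>\<bottom>"
    then obtain s f where w: "w = s + f" "s \<in> dual_cone K" "f \<in> F\<^sup>\<bottom>"
      by (rule set_plus_elim)
    have "0 \<le> w \<bullet> x" if "x \<in> F" for x
    proof -
      have "f \<bullet> x = 0"
        using w(3) that by (auto simp: orthogonal_comp_def orthogonal_def inner_commute)
      moreover have "0 \<le> s \<bullet> x"
        using w(2) that face_of_imp_subset [OF assms(3)] by (auto simp: dual_cone_def)
      ultimately show ?thesis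
        by (simp add: w(1) inner_add_left)
    qed
    then show "w \<in> dual_cone F"
      by (simp add: dual_cone_def)
  qed
  then show "closure (dual_cone K + F\<^sup>\<bottom>) \<subseteq> dual_cone F"
    by (simp add: closure_minimal closed_dual_cone)
  show "dual_cone F \<subseteq> closure (dual_cone K + F\<^sup>\<bottom>)"
  proof
    fix z assume z: "z \<in> dual_cone F"
    show "z \<in> closure (dual_cone K + F\<^sup>\<bottom>)"
    proof (rule ccontr)
      assume "z \<notin> closure (dual_cone K + F\<^sup>\<bottom>)"
      moreover have "convex_cone (dual_cone K + F\<^sup>\<bottom>)"
        by (simp add: convex_cone_set_plus convex_cone_dual_cone subspace_imp_convex_cone
            subspace_orthogonal_comp)
      ultimately obtain x where x: "x \<bullet> z < 0" "\<And>w. w \<in> dual_cone K + F\<^sup>\<bottom> \<Longrightarrow> 0 \<le> x \<bullet> w"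
        using separate_from_closure_convex_cone by blast
      have "x \<in> dual_cone (dual_cone K)" "x \<in> F\<^sup>\<bottom>\<^sup>\<bottom>"
        by (rule dual_cone_set_plus_subspace [OF convex_cone_dual_cone subspace_orthogonal_comp];
            use x(2) in blast)+
      then have "x \<in> F"
        using span_face_Int_convex_cone [OF assms(2-4)]
        by (auto simp: dual_cone_dual_cone [OF assms(1,2)] orthogonal_comp_orthogonal_comp)
      then show False
        using z x(1) by (fastforce simp: dual_cone_def inner_commute)
    qed
  qed
qed

section \<open>Facial reduction\<close>

lemma mem_orthogonal_comp_singleton: "x \<in> {a}\<^sup>\<bottom> \<longleftrightarrow> a \<bullet> x = 0"
  by (simp add: orthogonal_comp_def orthogonal_def)

lemma singleton_mem_FR_1: "z \<in> dual_cone C \<Longrightarrow> (\<lambda>i. z) \<in> FR 1 C"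
  by (simp add: FR_def)

text \<open>
  The inductive step of every facial reduction: cut the cone by one hyperplane, then continue
  with the cone that remains. With \<open>a = 0\<close> it lengthens a sequence.
\<close>

lemma FR_prepend:
  assumes "a \<in> dual_cone C" and b: "b \<in> FR n (C \<inter> {a}\<^sup>\<bottom>)"
  shows "(\<lambda>i. if i = 1 then a else b (i - 1)) \<in> FR (n + 1) C" (is "?y \<in> _")
proof -
  have "?y i \<in> dual_cone (C \<inter> (\<Inter>j\<in>{1..<i}. {?y j}\<^sup>\<bottom>))" if i: "i \<in> {2..n + 1}" for i
  proof -
    have "(\<Inter>j\<in>{1..<i}. {?y j}\<^sup>\<bottom>) = {a}\<^sup>\<bottom> \<inter> (\<Inter>j\<in>{1..<i - 1}. {b j}\<^sup>\<bottom>)"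
    proof -
      have "{1..<i} = insert 1 (Suc ` {1..<i - 1})"
        using i unfolding image_Suc_atLeastLessThan by auto
      moreover have "(\<Inter>j\<in>insert 1 (Suc ` {1..<i - 1}). {?y j}\<^sup>\<bottom>)
          = {a}\<^sup>\<bottom> \<inter> (\<Inter>j\<in>{1..<i - 1}. {b j}\<^sup>\<bottom>)"
        by (simp add: image_image del: image_Suc_atLeastLessThan)
      ultimately show ?thesis by (simp only:)
    qed
    moreover have "b (i - 1) \<in> dual_cone ((C \<inter> {a}\<^sup>\<bottom>) \<inter> (\<Inter>j\<in>{1..<i - 1}. {b j}\<^sup>\<bottom>))"
    proof (cases "i = 2")
      case True
      then show ?thesis using b by (simp add: FR_def)
    next
      case False
      then have "i - 1 \<in> {2..n}" using i by auto
      then show ?thesis using b unfolding FR_def by blast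
    qed
    ultimately show ?thesis
      using i by (simp add: Int_assoc)
  qed
  then show ?thesis
    using assms(1) by (simp add: FR_def)
qed

lemma dim_Int_orthogonal_comp_less:
  fixes C :: "'a::euclidean_space set"
  assumes "c \<in> C" "a \<bullet> c \<noteq> 0"
  shows "dim (C \<inter> {a}\<^sup>\<bottom>) < dim C"
proof (rule dim_psubset)
  have "span (C \<inter> {a}\<^sup>\<bottom>) \<subseteq> {a}\<^sup>\<bottom>"
    by (simp add: span_minimal subspace_orthogonal_comp)
  then have "c \<notin> span (C \<inter> {a}\<^sup>\<bottom>)"
    using assms(2) by (auto simp: mem_orthogonal_comp_singleton)
  moreover have "c \<in> span C"
    using assms(1) by (simp add: span_base)
  ultimately show "span (C \<inter> {a}\<^sup>\<bottom>) \<subset> span C"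
    using span_mono [of "C \<inter> {a}\<^sup>\<bottom>" C] by blast
qed

text \<open>
  A relative interior point \<open>f\<close> of \<open>F\<close> lies on the relative boundary of \<open>K\<close>, so there is a
  hyperplane supporting \<open>K\<close> at \<open>f\<close> without containing \<open>K\<close>. It contains \<open>0\<close> because \<open>K\<close> is a
  cone, and it contains all of \<open>F\<close> because it cuts out a face of \<open>K\<close> that meets the relative
  interior of \<open>F\<close>.
\<close>

lemma proper_face_supporting_hyperplane:
  fixes K :: "'a::euclidean_space set"
  assumes cone: "convex_cone K" and F: "F face_of K" "F \<noteq> {}" "F \<noteq> K"
  obtains a where "a \<in> dual_cone K" "a \<in> F\<^sup>\<bottom>" "dim (K \<inter> {a}\<^sup>\<bottom>) < dim K"
proof -
  have "convex K"
    using cone by (simp add: convex_cone_def)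
  obtain f where f: "f \<in> rel_interior F"
    using F(1,2) face_of_imp_convex rel_interior_eq_empty by blast
  have "f \<in> F" "f \<in> K"
    using f rel_interior_subset face_of_imp_subset [OF F(1)] by blast+
  then have "f \<notin> rel_interior K"
    using face_of_disjoint_rel_interior [OF F(1,3)] by blast
  then obtain a where a [rule_format]: "\<forall>x\<in>K. a \<bullet> f \<le> a \<bullet> x"
      "\<forall>x\<in>rel_interior K. a \<bullet> f < a \<bullet> x"
    using supporting_hyperplane_rel_boundary [OF \<open>convex K\<close> \<open>f \<in> K\<close>] by metis
  have nonneg: "0 \<le> a \<bullet> x" if "x \<in> K" for x
    using convex_cone_inner_nonneg [OF cone a(1) that] by blast
  have af: "a \<bullet> f = 0"
    using nonneg [OF \<open>f \<in> K\<close>] a(1) [OF convex_cone_contains_0 [OF cone]] by simp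
  have "(K \<inter> {x. a \<bullet> x = 0}) face_of K"
    by (rule face_of_Int_supporting_hyperplane_ge [OF \<open>convex K\<close> nonneg])
  moreover have "(K \<inter> {x. a \<bullet> x = 0}) \<inter> rel_interior F \<noteq> {}"
    using f af \<open>f \<in> K\<close> by blast
  ultimately have "F \<subseteq> K \<inter> {x. a \<bullet> x = 0}"
    using subset_of_face_of face_of_imp_subset [OF F(1)] by blast
  then have "a \<in> F\<^sup>\<bottom>"
    by (auto simp: orthogonal_comp_def orthogonal_def inner_commute)
  moreover have "a \<in> dual_cone K"
    using nonneg by (simp add: dual_cone_def)
  moreover obtain c where "c \<in> rel_interior K"
    using \<open>convex K\<close> \<open>f \<in> K\<close> rel_interior_eq_empty by blast
  then have "dim (K \<inter> {a}\<^sup>\<bottom>) < dim K"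
    using a(2) af rel_interior_subset by (fastforce intro: dim_Int_orthogonal_comp_less [of c])
  ultimately show thesis
    using that by blast
qed

text \<open>
  Supporting hyperplanes reduce \<open>K\<close> to \<open>F\<close> in finitely many steps. Any element of \<open>F\<^sup>*\<close>, even one
  outside \<open>K\<^sup>* + F\<^sup>\<bottom>\<close>, is then a legitimate last entry.
\<close>

lemma face_dual_facial_reduction:
  fixes K F :: "'a::euclidean_space set"
  assumes "convex_cone K" "F face_of K" "F \<noteq> {}" "z \<in> dual_cone F"
  shows "\<exists>l\<ge>1. \<exists>y \<in> FR (l + 1) K. (\<forall>j\<in>{1..l}. y j \<in> F\<^sup>\<bottom>) \<and> y (l + 1) = z"
  using assms(1,2)
proof (induction "dim K" arbitrary: K rule: less_induct)
  case less
  show ?case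
  proof (cases "F = K")
    case True
    \<comment> \<open>Cutting with \<open>0\<close> changes nothing; it only ensures that an entry precedes the last one.\<close>
    then have "(\<lambda>i. z) \<in> FR 1 (K \<inter> {0}\<^sup>\<bottom>)"
      using assms(4) by (simp add: singleton_mem_FR_1 del: One_nat_def)
    then have "(\<lambda>i. if i = 1 then 0 else z) \<in> FR (1 + 1) K"
      by (rule FR_prepend [rotated]) (simp add: dual_cone_def)
    moreover have "0 \<in> F\<^sup>\<bottom>"
      by (rule subspace_0 [OF subspace_orthogonal_comp])
    ultimately show ?thesis
      by (intro exI [of _ 1] conjI bexI [of _ "\<lambda>i. if i = 1 then 0 else z"]) auto
  next
    case False
    then obtain a where a: "a \<in> dual_cone K" "a \<in> F\<^sup>\<bottom>" "dim (K \<inter> {a}\<^sup>\<bottom>) < dim K"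
      using proper_face_supporting_hyperplane [OF less.prems assms(3)] by blast
    have "F \<subseteq> K \<inter> {a}\<^sup>\<bottom>"
      using a(2) face_of_imp_subset [OF less.prems(2)]
      by (auto simp: orthogonal_comp_def orthogonal_commute)
    then have "F face_of (K \<inter> {a}\<^sup>\<bottom>)"
      using face_of_subset [OF less.prems(2)] by blast
    then obtain l y where ly: "l \<ge> 1" "y \<in> FR (l + 1) (K \<inter> {a}\<^sup>\<bottom>)"
        "\<forall>j\<in>{1..l}. y j \<in> F\<^sup>\<bottom>" "y (l + 1) = z"
      using less.hyps [OF a(3) convex_cone_Int_orthogonal_comp [OF less.prems(1)]] by blast
    let ?y = "\<lambda>i. if i = 1 then a else y (i - 1)"
    have "?y \<in> FR (l + 1 + 1) K"
      by (rule FR_prepend [OF a(1) ly(2)])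
    moreover have "\<forall>j\<in>{1..l + 1}. ?y j \<in> F\<^sup>\<bottom>"
    proof
      fix j assume "j \<in> {1..l + 1}"
      then have "j = 1 \<or> j - 1 \<in> {1..l}" by auto
      then show "?y j \<in> F\<^sup>\<bottom>" using a(2) ly(3) by auto
    qed
    moreover have "?y (l + 1 + 1) = z"
      using ly(4) by simp
    moreover have "l + 1 \<ge> 1" by simp
    ultimately show ?thesis
      by (intro exI [of _ "l + 1"] conjI bexI [of _ ?y])
  qed
qed

text \<open>
  A point in the closure of \<open>C + L\<close> but outside \<open>C + L\<close> cannot be separated strictly. It still
  lies on the relative boundary, and so some hyperplane supports \<open>C + L\<close> there without containing
  it. That hyperplane passes through \<open>0\<close> and contains \<open>L\<close>, and hence cannot contain \<open>C\<close>.
\<close>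

lemma weak_separation_reduces_dim:
  fixes C L :: "'a::euclidean_space set"
  assumes C: "convex_cone C" and L: "subspace L" and "z \<notin> C + L" "z \<in> closure (C + L)"
  obtains a where "a \<in> dual_cone C" "a \<in> L\<^sup>\<bottom>" "a \<bullet> z = 0" "dim (C \<inter> {a}\<^sup>\<bottom>) < dim C"
proof -
  have cone: "convex_cone (C + L)"
    using C L by (simp add: convex_cone_set_plus subspace_imp_convex_cone)
  then have conv: "convex (C + L)"
    by (simp add: convex_cone_def)
  have "z \<notin> rel_interior (C + L)"
    using assms(3) rel_interior_subset by blast
  then obtain a where a [rule_format]: "\<forall>x\<in>closure (C + L). a \<bullet> z \<le> a \<bullet> x"
      "\<forall>x\<in>rel_interior (C + L). a \<bullet> z < a \<bullet> x"
    using supporting_hyperplane_relative_frontier [OF conv assms(4)] by metis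
  have nonneg: "0 \<le> a \<bullet> x" if "x \<in> C + L" for x
    using convex_cone_inner_nonneg [OF cone _ that] a(1) closure_subset by blast
  have az: "a \<bullet> z = 0"
  proof (rule antisym)
    show "a \<bullet> z \<le> 0"
      using a(1) [of 0] convex_cone_contains_0 [OF cone] closure_subset by fastforce
    have "closure (C + L) \<subseteq> {x. 0 \<le> a \<bullet> x}"
    proof (rule closure_minimal)
      show "C + L \<subseteq> {x. 0 \<le> a \<bullet> x}"
        using nonneg by blast
      show "closed {x. 0 \<le> a \<bullet> x}"
        using closed_halfspace_ge [of 0 a] by simp
    qed
    then show "0 \<le> a \<bullet> z"
      using assms(4) by blast
  qed
  have aC: "a \<in> dual_cone C" and aL: "a \<in> L\<^sup>\<bottom>"
    using dual_cone_set_plus_subspace [OF C L nonneg] by blast+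
  obtain w where w: "w \<in> rel_interior (C + L)"
    using conv convex_cone_nonempty [OF cone] rel_interior_eq_empty by blast
  then obtain c l where cl: "c \<in> C" "l \<in> L" "w = c + l"
    using rel_interior_subset by (blast elim: set_plus_elim)
  have "a \<bullet> l = 0"
    using aL cl(2) by (auto simp: orthogonal_comp_def orthogonal_def inner_commute)
  then have "a \<bullet> c \<noteq> 0"
    using a(2) [OF w] az cl(3) by (simp add: inner_add_right)
  then show thesis
    using that [OF aC aL az] dim_Int_orthogonal_comp_less [OF cl(1)] by blast
qed

text \<open>
  When \<open>C + L\<close> is not closed, \<open>z\<close> may be in its closure, and then no single functional can
  witness \<open>z \<notin> C + L\<close> with a strict sign. Each hyperplane that separates only weakly is therefore
  recorded in the sequence and used to shrink the cone, until strict separation is possible.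
\<close>

lemma infeasible_facial_reduction:
  fixes C L :: "'a::euclidean_space set"
  assumes "convex_cone C" "subspace L" "z \<notin> C + L"
  shows "\<exists>k\<ge>1. \<exists>a \<in> FR (k + 1) C. (\<forall>i\<in>{1..k + 1}. a i \<in> L\<^sup>\<bottom>) \<and>
    (\<forall>i\<in>{1..k + 1}. a i \<bullet> z = (if i \<le> k then 0 else -1))"
  using assms(1,3)
proof (induction "dim C" arbitrary: C rule: less_induct)
  case less
  show ?case
  proof (cases "z \<in> closure (C + L)")
    case False
    have "convex_cone (C + L)"
      using less.prems(1) assms(2) by (simp add: convex_cone_set_plus subspace_imp_convex_cone)
    then obtain a where a: "a \<bullet> z < 0" "\<And>x. x \<in> C + L \<Longrightarrow> 0 \<le> a \<bullet> x"
      using False separate_from_closure_convex_cone by blast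
    define b where "b = (1 / (- (a \<bullet> z))) *\<^sub>R a"
    have bz: "b \<bullet> z = -1"
      using a(1) by (simp add: b_def)
    have "0 \<le> b \<bullet> x" if "x \<in> C + L" for x
      using a(1) a(2) [OF that] by (simp add: b_def divide_nonneg_neg)
    then have b: "b \<in> dual_cone C" "b \<in> L\<^sup>\<bottom>"
      using dual_cone_set_plus_subspace [OF less.prems(1) assms(2)] by blast+
    \<comment> \<open>Cutting with \<open>0\<close> changes nothing; it only ensures that an entry precedes the last one.\<close>
    have "(\<lambda>i. b) \<in> FR 1 (C \<inter> {0}\<^sup>\<bottom>)"
      using b(1) by (simp add: singleton_mem_FR_1 del: One_nat_def)
    then have "(\<lambda>i. if i = 1 then 0 else b) \<in> FR (1 + 1) C"
      by (rule FR_prepend [rotated]) (simp add: dual_cone_def)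
    moreover have "0 \<in> L\<^sup>\<bottom>"
      by (rule subspace_0 [OF subspace_orthogonal_comp])
    ultimately show ?thesis
      using b(2) bz
      by (intro exI [of _ 1] conjI bexI [of _ "\<lambda>i. if i = 1 then 0 else b"]) auto
  next
    case True
    then obtain b where b: "b \<in> dual_cone C" "b \<in> L\<^sup>\<bottom>" "b \<bullet> z = 0" "dim (C \<inter> {b}\<^sup>\<bottom>) < dim C"
      using weak_separation_reduces_dim [OF less.prems(1) assms(2) less.prems(2)] by blast
    have "z \<notin> (C \<inter> {b}\<^sup>\<bottom>) + L"
      using less.prems(2) set_plus_mono2 [of "C \<inter> {b}\<^sup>\<bottom>" C L L] by blast
    then obtain k a where ka: "k \<ge> 1" "a \<in> FR (k + 1) (C \<inter> {b}\<^sup>\<bottom>)"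
        "\<forall>i\<in>{1..k + 1}. a i \<in> L\<^sup>\<bottom>"
        "\<forall>i\<in>{1..k + 1}. a i \<bullet> z = (if i \<le> k then 0 else -1)"
      using less.hyps [OF b(4) convex_cone_Int_orthogonal_comp [OF less.prems(1)]] by blast
    let ?a = "\<lambda>i. if i = 1 then b else a (i - 1)"
    have "?a \<in> FR (k + 1 + 1) C"
      by (rule FR_prepend [OF b(1) ka(2)])
    moreover have "\<forall>i\<in>{1..k + 1 + 1}. ?a i \<in> L\<^sup>\<bottom>"
    proof
      fix i assume "i \<in> {1..k + 1 + 1}"
      then have "i = 1 \<or> i - 1 \<in> {1..k + 1}" by auto
      then show "?a i \<in> L\<^sup>\<bottom>" using b(2) ka(3) by auto
    qed
    moreover have "\<forall>i\<in>{1..k + 1 + 1}. ?a i \<bullet> z = (if i \<le> k + 1 then 0 else -1)"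
    proof
      fix i assume i: "i \<in> {1..k + 1 + 1}"
      show "?a i \<bullet> z = (if i \<le> k + 1 then 0 else -1)"
      proof (cases "i = 1")
        case True
        then show ?thesis using b(3) by simp
      next
        case False
        then have "i - 1 \<in> {1..k + 1}" "i - 1 \<le> k \<longleftrightarrow> i \<le> k + 1" using i by auto
        then show ?thesis using ka(4) False by simp
      qed
    qed
    moreover have "k + 1 \<ge> 1" by simp
    ultimately show ?thesis
      by (intro exI [of _ "k + 1"] conjI bexI [of _ ?a])
  qed
qed

section \<open>The certificate of nonclosedness\<close>

theorem theorem7:
  fixes K F :: "'a::euclidean_space set"
  assumes "closed K" and "convex_cone K" and "F face_of K"
  shows "\<not> closed (dual_cone K + F\<^sup>\<bottom>) \<longleftrightarrow>
    (\<exists>k \<ge> 1. \<exists>l \<ge> 1. \<exists>a \<in> FR (k + 1) (dual_cone K). \<exists>y \<in> FR (l + 1) K.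
      (\<forall>i\<in>{1..k+1}. a i \<in> span F) \<and>
      (\<forall>j\<in>{1..l}. y j \<in> F\<^sup>\<bottom>) \<and>
      (\<forall>i\<in>{1..k+1}. a i \<bullet> y (l + 1) = (if i \<le> k then 0 else -1)))"
    (is "_ \<longleftrightarrow> ?certificate")
proof (cases "F = {}")
  case True
  \<comment> \<open>The empty set is a face too; the sum is then the whole space, and \<open>lin F = 0\<close> rules out
    the value \<open>-1\<close>.\<close>
  have "F\<^sup>\<bottom> = UNIV"
    using True by (simp add: orthogonal_comp_def)
  then have "dual_cone K + F\<^sup>\<bottom> = UNIV"
    using set_zero_plus2 [OF convex_cone_contains_0 [OF convex_cone_dual_cone], of "F\<^sup>\<bottom>" K]
    by auto
  moreover have "\<not> ?certificate"
  proof
    assume ?certificate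
    then obtain k l :: nat and a y :: "nat \<Rightarrow> 'a"
      where "\<forall>i\<in>{1..k+1}. a i \<in> span F"
        and "\<forall>i\<in>{1..k+1}. a i \<bullet> y (l + 1) = (if i \<le> k then 0 else -1)"
      by blast
    then have "a (k + 1) \<in> span F" "a (k + 1) \<bullet> y (l + 1) = -1"
      by simp_all
    then show False using True by simp
  qed
  ultimately show ?thesis by simp
next
  case False
  have closure: "closure (dual_cone K + F\<^sup>\<bottom>) = dual_cone F"
    by (rule closure_dual_cone_plus_orthogonal_comp [OF assms False])
  show ?thesis
  proof
    assume "\<not> closed (dual_cone K + F\<^sup>\<bottom>)"
    then have "dual_cone K + F\<^sup>\<bottom> \<noteq> dual_cone F"
      using closed_dual_cone [of F] by metis
    moreover have "dual_cone K + F\<^sup>\<bottom> \<subseteq> dual_cone F"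
      using closure_subset [of "dual_cone K + F\<^sup>\<bottom>"] unfolding closure .
    ultimately obtain z where z: "z \<in> dual_cone F" "z \<notin> dual_cone K + F\<^sup>\<bottom>"
      by blast
    obtain l y where "l \<ge> 1" "y \<in> FR (l + 1) K" "\<forall>j\<in>{1..l}. y j \<in> F\<^sup>\<bottom>" "y (l + 1) = z"
      using face_dual_facial_reduction [OF assms(2,3) False z(1)] by blast
    moreover obtain k a where "k \<ge> 1" "a \<in> FR (k + 1) (dual_cone K)"
        "\<forall>i\<in>{1..k + 1}. a i \<in> span F"
        "\<forall>i\<in>{1..k + 1}. a i \<bullet> z = (if i \<le> k then 0 else -1)"
      using infeasible_facial_reduction [OF convex_cone_dual_cone subspace_orthogonal_comp z(2)]
      unfolding orthogonal_comp_orthogonal_comp by blast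
    ultimately show ?certificate by blast
  next
    assume ?certificate
    then obtain k l :: nat and a y :: "nat \<Rightarrow> 'a"
      where kl: "k \<ge> 1" "l \<ge> 1"
        and FR: "a \<in> FR (k + 1) (dual_cone K)" "y \<in> FR (l + 1) K"
        and aF: "\<forall>i\<in>{1..k+1}. a i \<in> span F" and yF: "\<forall>j\<in>{1..l}. y j \<in> F\<^sup>\<bottom>"
        and ay: "\<forall>i\<in>{1..k+1}. a i \<bullet> y (l + 1) = (if i \<le> k then 0 else -1)"
      by blast
    show "\<not> closed (dual_cone K + F\<^sup>\<bottom>)"
    proof
      assume "closed (dual_cone K + F\<^sup>\<bottom>)"
      then have sum: "dual_cone K + F\<^sup>\<bottom> = dual_cone F"
        using closure by simp
      have "l + 1 \<in> {2..l + 1}"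
        using kl(2) by simp
      then have "y (l + 1) \<in> dual_cone (K \<inter> (\<Inter>j\<in>{1..<l + 1}. {y j}\<^sup>\<bottom>))"
        using FR(2) unfolding FR_def by blast
      moreover have "F \<subseteq> K \<inter> (\<Inter>j\<in>{1..<l + 1}. {y j}\<^sup>\<bottom>)"
        using face_of_imp_subset [OF assms(3)] yF
        by (auto simp: orthogonal_comp_def orthogonal_commute)
      ultimately have "y (l + 1) \<in> dual_cone F"
        unfolding dual_cone_def by blast
      then obtain s f where sf: "s \<in> dual_cone K" "f \<in> F\<^sup>\<bottom>" "y (l + 1) = s + f"
        unfolding sum [symmetric] by (rule set_plus_elim)
      have as: "a i \<bullet> s = (if i \<le> k then 0 else -1)" if i: "i \<in> {1..k+1}" for i
      proof -
        have "a i \<in> F\<^sup>\<bottom>\<^sup>\<bottom>"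
          using aF i by (simp add: orthogonal_comp_orthogonal_comp)
        then have "a i \<bullet> f = 0"
          using sf(2) by (auto simp: orthogonal_comp_def [of "F\<^sup>\<bottom>"] orthogonal_def inner_commute)
        then show ?thesis
          using bspec [OF ay i] sf(3) by (simp add: inner_add_right)
      qed
      then have "s \<in> dual_cone K \<inter> (\<Inter>j\<in>{1..<k + 1}. {a j}\<^sup>\<bottom>)"
        using sf(1) by (auto simp: mem_orthogonal_comp_singleton)
      moreover have "k + 1 \<in> {2..k + 1}"
        using kl(1) by simp
      then have "a (k + 1) \<in> dual_cone (dual_cone K \<inter> (\<Inter>j\<in>{1..<k + 1}. {a j}\<^sup>\<bottom>))"
        using FR(1) unfolding FR_def by blast
      ultimately have "0 \<le> a (k + 1) \<bullet> s"
        unfolding dual_cone_def by blast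
      then show False
        using as [of "k + 1"] by simp
    qed
  qed
qed

end
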